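(* Let $\lambda_1>\lambda_2>\lambda_3>\lambda_4$ be real numbers with $\lambda_i+\lambda_j>0$ for all $i\neq j$, and consider the $\mathfrak{so}(4)$ free rigid body system on $\mathfrak{so}(4)\cong\mathbb{R}^6$ given in the context. Let $c_1,c_2\in\mathbb{R}$ with $c_1>0$, $c_1>|c_2|$, and set $$a=\tfrac{1}{\sqrt2}\left(\sqrt{c_1+c_2}+\sqrt{c_1-c_2}\right),\qquad b=\tfrac{1}{\sqrt2}\left(\sqrt{c_1+c_2}-\sqrt{c_1-c_2}\right),$$ so that $0\le \frac{b^2}{a^2}<1$. Let $\alpha_1<\alpha_2$ be the two (distinct, real) roots of the quadratic function $\widetilde f$ defined in the context. Then the equilibria $M^1_{b,a}$ and $M^1_{-b,-a}$ have the following spectral stability behavior on the regular orbit $\{C_1=c_1,\ C_2=c_2\}$: (i) if $\lambda_1^2+\lambda_4^2=\lambda_2^2+\lambda_3^2$, then $M^1_{b,a}$ and $M^1_{-b,-a}$ are spectrally unstable; if $\lambda_1^2+\lambda_4^2\neq\lambda_2^2+\lambda_3^2$, then $M^1_{b,a}$ and $M^1_{-b,-a}$ are spectrally unstable for $\frac{b^2}{a^2}\in[0,\alpha_2)$; (ii) if $\lambda_1^2+\lambda_4^2\neq\lambda_2^2+\lambda_3^2$, then $M^1_{b,a}$ and $M^1_{-b,-a}$ are spectrally stable for $\frac{b^2}{a^2}\in[\alpha_2,1)$.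
   Context: The $\mathfrak{so}(4)$ free rigid body is the system $\dot M=[M,\Omega]$, $M=\Omega J+J\Omega$, $J=\operatorname{diag}(\lambda_1,\dots,\lambda_4)$, $M,\Omega\in\mathfrak{so}(4)$. Writing $$M=\begin{pmatrix}0&-x_3&x_2&y_1\\ x_3&0&-x_1&y_2\\ -x_2&x_1&0&y_3\\ -y_1&-y_2&-y_3&0\end{pmatrix}$$ and $\lambda_{ij}:=\lambda_i+\lambda_j$, it reads $$\begin{aligned} \dot x_1&=\left(\tfrac1{\lambda_{12}}-\tfrac1{\lambda_{13}}\right)x_2x_3+\left(\tfrac1{\lambda_{34}}-\tfrac1{\lambda_{24}}\right)y_2y_3, & \dot y_1&=\left(\tfrac1{\lambda_{34}}-\tfrac1{\lambda_{13}}\right)x_2y_3+\left(\tfrac1{\lambda_{12}}-\tfrac1{\lambda_{24}}\right)x_3y_2,\\ \dot x_2&=\left(\tfrac1{\lambda_{23}}-\tfrac1{\lambda_{12}}\right)x_1x_3+\left(\tfrac1{\lambda_{14}}-\tfrac1{\lambda_{34}}\right)y_1y_3, & \dot y_2&=\left(\tfrac1{\lambda_{23}}-\tfrac1{\lambda_{34}}\right)x_1y_3+\left(\tfrac1{\lambda_{14}}-\tfrac1{\lambda_{12}}\right)x_3y_1,\\ \dot x_3&=\left(\tfrac1{\lambda_{13}}-\tfrac1{\lambda_{23}}\right)x_1x_2+\left(\tfrac1{\lambda_{24}}-\tfrac1{\lambda_{14}}\right)y_1y_2, & \dot y_3&=\left(\tfrac1{\lambda_{24}}-\tfrac1{\lambda_{23}}\right)x_1y_2+\left(\tfrac1{\lambda_{13}}-\tfrac1{\lambda_{14}}\right)x_2y_1.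 \end{aligned}$$ Casimir functions (constants of motion): $C_1=\frac12\sum_{i=1}^3(x_i^2+y_i^2)$, $C_2=\sum_{i=1}^3x_iy_i$. For $\alpha,\beta\in\mathbb{R}$, the equilibrium $M^1_{\alpha,\beta}$ is the point with $x_1=\alpha$, $y_1=\beta$ and all other coordinates $0$. The quadratic function: $\widetilde f(t)=\widetilde S t^2+\widetilde T t+\widetilde U$ with $$\widetilde S=(\lambda_1^2-\lambda_4^2)^2,\quad \widetilde U=(\lambda_2^2-\lambda_3^2)^2,\quad \widetilde T=-2\left[(\lambda_1^2-\lambda_2^2)(\lambda_3^2-\lambda_4^2)+(\lambda_1^2-\lambda_3^2)(\lambda_2^2-\lambda_4^2)\right].$$ Its roots satisfy $0<\alpha_1<\alpha_2\le1$, with $\alpha_2=1$ if and only if $\lambda_1^2+\lambda_4^2=\lambda_2^2+\lambda_3^2$. Spectral stability on the orbit: let $L$ be the linearization of the vector field at the equilibrium $M_e$, restricted to the tangent space $\ker dC_1(M_e)\cap\ker dC_2(M_e)$ of the orbit through $M_e$ (an $L$-invariant 4-dimensional subspace). $M_e$ is spectrally unstable if $L$ has an eigenvalue with strictly positive real part, and spectrally stable if all eigenvalues of $L$ have zero real part. *)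

theory Defs
  imports "HOL-Analysis.Analysis"
begin

section \<open>The free rigid body on so(4)\<close>

text \<open>
  A point \<open>M\<close> of so(4) is represented by its coordinates \<open>(x, y)\<close>, with
  \<open>x = (x\<^sub>1, x\<^sub>2, x\<^sub>3)\<close> and \<open>y = (y\<^sub>1, y\<^sub>2, y\<^sub>3)\<close>; the parameters \<open>\<lambda>\<^sub>1, \<dots>, \<lambda>\<^sub>4\<close> form the vector \<open>l\<close>.
  The index type \<open>4\<close> has the elements \<open>1, 2, 3, 4\<close>, where \<open>4 = 0\<close>.
\<close>

type_synonym so4 = "(real ^ 3) \<times> (real ^ 3)"

definition so4_matrix :: "so4 \<Rightarrow> real ^ 4 ^ 4" where
  "so4_matrix z = (let x = fst z; y = snd z in
     vector [vector [0,      - (x$3), x$2,    y$1],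
             vector [x$3,    0,       - (x$1), y$2],
             vector [- (x$2), x$1,    0,      y$3],
             vector [- (y$1), - (y$2), - (y$3), 0]])"

definition diag_matrix :: "real ^ 'n \<Rightarrow> real ^ 'n ^ 'n" where
  "diag_matrix d = (\<chi> i j. if i = j then d $ i else 0)"

definition rigid_body :: "real ^ 4 \<Rightarrow> so4 \<Rightarrow> so4" where
  "rigid_body l z = (let x = fst z; y = snd z; \<kappa> = (\<lambda>i j. 1 / (l$i + l$j)) in
     (vector
       [(\<kappa> 1 2 - \<kappa> 1 3) * x$2 * x$3 + (\<kappa> 3 4 - \<kappa> 2 4) * y$2 * y$3,
        (\<kappa> 2 3 - \<kappa> 1 2) * x$1 * x$3 + (\<kappa> 1 4 - \<kappa> 3 4) * y$1 * y$3,
        (\<kappa> 1 3 - \<kappa> 2 3) * x$1 * x$2 + (\<kappa> 2 4 - \<kappa> 1 4) * y$1 * y$2],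
      vector
       [(\<kappa> 3 4 - \<kappa> 1 3) * x$2 * y$3 + (\<kappa> 1 2 - \<kappa> 2 4) * x$3 * y$2,
        (\<kappa> 2 3 - \<kappa> 3 4) * x$1 * y$3 + (\<kappa> 1 4 - \<kappa> 1 2) * x$3 * y$1,
        (\<kappa> 2 4 - \<kappa> 2 3) * x$1 * y$2 + (\<kappa> 1 3 - \<kappa> 1 4) * x$2 * y$1]))"

definition casimir1 :: "so4 \<Rightarrow> real" where
  "casimir1 z = 1/2 * (\<Sum>i\<in>UNIV. (fst z $ i)\<^sup>2 + (snd z $ i)\<^sup>2)"

definition casimir2 :: "so4 \<Rightarrow> real" where
  "casimir2 z = (\<Sum>i\<in>UNIV. fst z $ i * snd z $ i)"

definition orbit :: "real \<Rightarrow> real \<Rightarrow> so4 set" where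
  "orbit c1 c2 = {z. casimir1 z = c1 \<and> casimir2 z = c2}"

definition M1 :: "real \<Rightarrow> real \<Rightarrow> so4" where
  "M1 \<alpha> \<beta> = (axis 1 \<alpha>, axis 1 \<beta>)"

definition equilibrium :: "('a \<Rightarrow> 'a::zero) \<Rightarrow> 'a \<Rightarrow> bool" where
  "equilibrium F z \<longleftrightarrow> F z = 0"

section \<open>Spectral stability on the orbit\<close>

definition orbit_tangent :: "so4 \<Rightarrow> so4 set" where
  "orbit_tangent z = {v. frechet_derivative casimir1 (at z) v = 0 \<and>
                         frechet_derivative casimir2 (at z) v = 0}"

text \<open>
  Complex eigenvalues of the restriction of a real linear map \<open>L\<close> to a real subspace \<open>V\<close>,
  that is, eigenvalues of its complexification. The pair \<open>(u, w)\<close> stands for the vector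
  \<open>u + \<i> w\<close> in the complexification of \<open>V\<close>; the two equations are the real and the imaginary
  part of \<open>L (u + \<i> w) = \<mu> (u + \<i> w)\<close>.
\<close>

definition eigenvalue_on :: "('a::real_vector \<Rightarrow> 'a) \<Rightarrow> 'a set \<Rightarrow> complex \<Rightarrow> bool" where
  "eigenvalue_on L V \<mu> \<longleftrightarrow>
     (\<exists>u\<in>V. \<exists>w\<in>V. (u, w) \<noteq> (0, 0) \<and>
        L u = Re \<mu> *\<^sub>R u - Im \<mu> *\<^sub>R w \<and>
        L w = Re \<mu> *\<^sub>R w + Im \<mu> *\<^sub>R u)"

definition spectrally_unstable :: "(so4 \<Rightarrow> so4) \<Rightarrow> so4 \<Rightarrow> bool" where
  "spectrally_unstable F z \<longleftrightarrow>
     (\<exists>\<mu>. eigenvalue_on (frechet_derivative F (at z)) (orbit_tangent z) \<mu> \<and> Re \<mu> > 0)"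

definition spectrally_stable :: "(so4 \<Rightarrow> so4) \<Rightarrow> so4 \<Rightarrow> bool" where
  "spectrally_stable F z \<longleftrightarrow>
     (\<forall>\<mu>. eigenvalue_on (frechet_derivative F (at z)) (orbit_tangent z) \<mu> \<longrightarrow> Re \<mu> = 0)"

section \<open>The quadratic function\<close>

definition f_tilde :: "real ^ 4 \<Rightarrow> real \<Rightarrow> real" where
  "f_tilde l t =
     (let S = ((l$1)\<^sup>2 - (l$4)\<^sup>2)\<^sup>2;
          U = ((l$2)\<^sup>2 - (l$3)\<^sup>2)\<^sup>2;
          T = - 2 * (((l$1)\<^sup>2 - (l$2)\<^sup>2) * ((l$3)\<^sup>2 - (l$4)\<^sup>2) +
                     ((l$1)\<^sup>2 - (l$3)\<^sup>2) * ((l$2)\<^sup>2 - (l$4)\<^sup>2))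
      in S * t\<^sup>2 + T * t + U)"

section \<open>Consistency of the definitions\<close>

lemma vec4_nth [simp]:
  "(vector [a, b, c, d] :: 'a::zero ^ 4) $ 1 = a"
  "(vector [a, b, c, d] :: 'a::zero ^ 4) $ 2 = b"
  "(vector [a, b, c, d] :: 'a::zero ^ 4) $ 3 = c"
  "(vector [a, b, c, d] :: 'a::zero ^ 4) $ 4 = d"
  unfolding vector_def by simp_all

lemma rigid_body_commutator:
  fixes l :: "real ^ 4" and \<Omega> :: "real ^ 4 ^ 4"
  assumes pos: "\<And>i j. i \<noteq> j \<Longrightarrow> l$i + l$j > 0"
    and skew: "transpose \<Omega> = - \<Omega>"
    and M: "so4_matrix z = \<Omega> ** diag_matrix l + diag_matrix l ** \<Omega>"
  shows "so4_matrix (rigid_body l z) = so4_matrix z ** \<Omega> - \<Omega> ** so4_matrix z"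
proof -
  have "\<Omega>$j$i = - \<Omega>$i$j" for i j
    using arg_cong[OF skew, of "\<lambda>A. A$i$j"] by (simp add: transpose_def)
  have entry: "so4_matrix z $ i $ j = (l$i + l$j) * \<Omega>$i$j" for i j
    unfolding M by (simp add: matrix_matrix_mult_def diag_matrix_def if_distrib
        if_distribR sum.delta sum.delta' algebra_simps cong: if_cong)
  define \<kappa> where "\<kappa> i j = 1 / (l$i + l$j)" for i j
  have \<kappa>_sym: "\<kappa> 2 1 = \<kappa> 1 2" "\<kappa> 3 1 = \<kappa> 1 3" "\<kappa> 4 1 = \<kappa> 1 4"
    "\<kappa> 3 2 = \<kappa> 2 3" "\<kappa> 4 2 = \<kappa> 2 4" "\<kappa> 4 3 = \<kappa> 3 4"
    by (simp_all add: \<kappa>_def add.commute)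
  have off: "\<Omega>$i$j = so4_matrix z $ i $ j * \<kappa> i j" if "i \<noteq> j" for i j
    using entry[of i j] pos[OF that] by (simp add: \<kappa>_def)
  have dia: "\<Omega>$i$i = 0" for i
    using \<open>\<And>j i. \<Omega>$j$i = - \<Omega>$i$j\<close>[of i i] by simp
  have entries: "so4_matrix w $ 1 = vector [0, - (fst w $ 3), fst w $ 2, snd w $ 1]"
    "so4_matrix w $ 2 = vector [fst w $ 3, 0, - (fst w $ 1), snd w $ 2]"
    "so4_matrix w $ 3 = vector [- (fst w $ 2), fst w $ 1, 0, snd w $ 3]"
    "so4_matrix w $ 4 = vector [- (snd w $ 1), - (snd w $ 2), - (snd w $ 3), 0]" for w
    by (simp_all add: so4_matrix_def Let_def)
  have \<Omega>: "\<Omega>$1 = vector [0, - (fst z $ 3) * \<kappa> 1 2, fst z $ 2 * \<kappa> 1 3, snd z $ 1 * \<kappa> 1 4]"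
    "\<Omega>$2 = vector [fst z $ 3 * \<kappa> 1 2, 0, - (fst z $ 1) * \<kappa> 2 3, snd z $ 2 * \<kappa> 2 4]"
    "\<Omega>$3 = vector [- (fst z $ 2) * \<kappa> 1 3, fst z $ 1 * \<kappa> 2 3, 0, snd z $ 3 * \<kappa> 3 4]"
    "\<Omega>$4 = vector [- (snd z $ 1) * \<kappa> 1 4, - (snd z $ 2) * \<kappa> 2 4, - (snd z $ 3) * \<kappa> 3 4, 0]"
    by (simp_all add: vec_eq_iff forall_4 dia off entries \<kappa>_sym)
  show ?thesis
    unfolding vec_eq_iff forall_4
    by (simp add: matrix_matrix_mult_def sum_4 entries \<Omega>,
        simp add: rigid_body_def Let_def \<kappa>_def[symmetric] algebra_simps)
qed

lemma casimir_inner: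
  "casimir1 z = (fst z \<bullet> fst z + snd z \<bullet> snd z) / 2"
  "casimir2 z = fst z \<bullet> snd z"
  by (simp_all add: casimir1_def casimir2_def inner_vec_def sum.distrib power2_eq_square)

lemma frechet_derivative_casimir:
  "frechet_derivative casimir1 (at z) = (\<lambda>v. z \<bullet> v)"
  "frechet_derivative casimir2 (at z) = (\<lambda>v. (snd z, fst z) \<bullet> v)"
proof -
  have "((\<lambda>z::so4. (fst z \<bullet> fst z + snd z \<bullet> snd z) / 2) has_derivative (\<lambda>v. z \<bullet> v)) (at z)"
    by (auto intro!: derivative_eq_intros simp: inner_prod_def inner_commute)
  then show "frechet_derivative casimir1 (at z) = (\<lambda>v. z \<bullet> v)"
    unfolding casimir_inner(1)[abs_def, symmetric] by (rule frechet_derivative_at[symmetric])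
  have "((\<lambda>z::so4. fst z \<bullet> snd z) has_derivative (\<lambda>v. (snd z, fst z) \<bullet> v)) (at z)"
    by (auto intro!: derivative_eq_intros simp: inner_prod_def inner_commute)
  then show "frechet_derivative casimir2 (at z) = (\<lambda>v. (snd z, fst z) \<bullet> v)"
    unfolding casimir_inner(2)[abs_def, symmetric] by (rule frechet_derivative_at[symmetric])
qed

text \<open>
  The orbits with \<open>c\<^sub>1 > \<bar>c\<^sub>2\<bar>\<close> are regular: \<open>dC\<^sub>1\<close> and \<open>dC\<^sub>2\<close> are independent along them.
\<close>

lemma dim_orbit_tangent:
  assumes "c1 > \<bar>c2\<bar>" and z: "z \<in> orbit c1 c2"
  shows "dim (orbit_tangent z) = 4"
proof -
  define z' where "z' = (snd z, fst z)"
  have C: "z \<bullet> z = 2 * c1" "z' \<bullet> z' = 2 * c1" "z \<bullet> z' = 2 * c2" "z' \<bullet> z = 2 * c2"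
    using z by (auto simp: orbit_def casimir_inner z'_def inner_prod_def inner_commute)
  have c1: "c1 > 0" using assms(1) by linarith
  have sq: "c2 * c2 < c1 * c1"
    using assms(1) by (metis abs_ge_zero abs_mult_self_eq mult_strict_mono' )
  have nspan: "z' \<notin> span {z}"
  proof
    assume "z' \<in> span {z}"
    then obtain k where k: "z' = k *\<^sub>R z" by (auto simp: span_singleton)
    have "2 * c2 = k * (2 * c1)" "2 * c1 = k * (2 * c2)"
      using C unfolding k by auto
    then have "c1 * c1 = c2 * c2" by (metis mult.assoc mult.commute mult_cancel_left zero_neq_numeral)
    then show False using sq by simp
  qed
  have "z \<noteq> 0" using C c1 by auto
  then have ind: "independent {z', z}" and ne: "z' \<noteq> z"
    using nspan by (auto simp: independent_insert span_base)
  have d2: "dim (span {z', z}) = 2"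
    using ind ne by (simp add: dim_eq_card_independent)
  have "orbit_tangent z = {v. \<forall>u\<in>span {z', z}. orthogonal u v}"
  proof -
    have "orbit_tangent z = {v. \<forall>u\<in>{z', z}. orthogonal v u}"
      by (auto simp: orbit_tangent_def frechet_derivative_casimir z'_def orthogonal_def inner_commute)
    also have "\<dots> = {v. \<forall>u\<in>span {z', z}. orthogonal u v}"
    proof (intro equalityI subsetI CollectI ballI)
      fix v u assume "v \<in> {v. \<forall>u\<in>{z', z}. orthogonal v u}" "u \<in> span {z', z}"
      then show "orthogonal u v"
        using orthogonal_to_span[of u "{z', z}" v] orthogonal_commute[of u v] by blast
    next
      fix v u assume "v \<in> {v. \<forall>u\<in>span {z', z}. orthogonal u v}" "u \<in> {z', z}"
      then show "orthogonal v u"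
        using span_base[of u "{z', z}"] orthogonal_commute[of u v] by blast
    qed
    finally show ?thesis .
  qed
  then have "dim (orbit_tangent z) + dim (span {z', z}) = dim (UNIV :: so4 set)"
    using dim_subspace_orthogonal_to_vectors[of "span {z', z}" "UNIV :: so4 set"] by simp
  then show ?thesis using d2 by (simp add: dim_UNIV)
qed

lemma f_tilde_two_roots:
  fixes l :: "real ^ 4"
  assumes "l$1 > l$2" "l$2 > l$3" "l$3 > l$4"
    and pos: "\<And>i j. i \<noteq> j \<Longrightarrow> l$i + l$j > 0"
  shows "\<exists>\<alpha>1 \<alpha>2. \<alpha>1 < \<alpha>2 \<and> {t. f_tilde l t = 0} = {\<alpha>1, \<alpha>2}"
proof -
  have sq: "(l$j)\<^sup>2 < (l$i)\<^sup>2" if "l$j < l$i" for i j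
  proof -
    have "0 < (l$i - l$j) * (l$i + l$j)"
      using that pos[of i j] by (intro mult_pos_pos) auto
    then show ?thesis by (simp add: power2_eq_square algebra_simps)
  qed
  define p where "p i = (l$i)\<^sup>2" for i
  have p: "p 2 < p 1" "p 3 < p 2" "p 4 < p 3"
    unfolding p_def using assms by (auto intro: sq)
  define A where "A = (p 1 - p 2) * (p 3 - p 4)"
  define B where "B = (p 1 - p 3) * (p 2 - p 4)"
  define r where "r = sqrt (A * B)"
  define s where "s = p 1 - p 4"
  have AB: "A > 0" "B > 0" unfolding A_def B_def using p by (auto intro: mult_pos_pos)
  have s: "s > 0" unfolding s_def using p by simp
  have r: "r > 0" "r\<^sup>2 = A * B" unfolding r_def using AB by (simp_all add: less_imp_le)
  have su: "s * (p 2 - p 3) = B - A" unfolding s_def A_def B_def by (simp add: algebra_simps)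
  have f: "s\<^sup>2 * f_tilde l t = (s\<^sup>2 * t - (A + B))\<^sup>2 - (2 * r)\<^sup>2" for t
  proof -
    have "s\<^sup>2 * f_tilde l t = (s\<^sup>2 * t)\<^sup>2 - 2 * (A + B) * (s\<^sup>2 * t) + (s * (p 2 - p 3))\<^sup>2"
      unfolding f_tilde_def Let_def s_def A_def B_def p_def
      by (simp add: power2_eq_square algebra_simps)
    then show ?thesis unfolding su power_mult_distrib[of 2 r] r(2)
      by (simp add: power2_eq_square algebra_simps)
  qed
  have "f_tilde l t = 0 \<longleftrightarrow> t = (A + B - 2*r) / s\<^sup>2 \<or> t = (A + B + 2*r) / s\<^sup>2" for t
  proof -
    have "f_tilde l t = 0 \<longleftrightarrow> (s\<^sup>2 * t - (A + B))\<^sup>2 = (2 * r)\<^sup>2"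
      using f[of t] s by auto
    also have "\<dots> \<longleftrightarrow> s\<^sup>2 * t - (A + B) = 2*r \<or> s\<^sup>2 * t - (A + B) = - (2*r)"
      by (rule power2_eq_iff)
    also have "\<dots> \<longleftrightarrow> t = (A + B - 2*r) / s\<^sup>2 \<or> t = (A + B + 2*r) / s\<^sup>2"
      using s by (auto simp: field_simps)
    finally show ?thesis .
  qed
  moreover have "(A + B - 2*r) / s\<^sup>2 < (A + B + 2*r) / s\<^sup>2"
    using s r by (simp add: divide_strict_right_mono)
  ultimately show ?thesis by blast
qed

end

theory Submission
  imports Defs
begin

text \<open>
  On the tangent space \<open>x\<^sub>1 = y\<^sub>1 = 0\<close> the linearization at \<open>(x\<^sub>1, y\<^sub>1) = (b, a)\<close> exchanges the planes
  \<open>(x\<^sub>2, y\<^sub>2)\<close> and \<open>(x\<^sub>3, y\<^sub>3)\<close>, through \<open>2 \<times> 2\<close> matrices \<open>A\<close> and \<open>B\<close>. Its eigenvalues are therefore the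
  solutions of \<open>\<mu>\<^sup>4 - T \<mu>\<^sup>2 + D = 0\<close> with \<open>T = tr (A B)\<close> and \<open>D = det (A B)\<close>. Here \<open>D\<close> is nonnegative (a
  positive multiple of the square of a linear function of \<open>t = b\<^sup>2 / a\<^sup>2\<close>), so the spectrum is imaginary
  iff \<open>T\<^sup>2 - 4 D \<ge> 0\<close> and \<open>T \<le> 0\<close>. Now \<open>T\<close> is decreasing and affine in \<open>t\<close>, and \<open>T\<^sup>2 - 4 D\<close> is a
  nonnegative multiple of \<open>f_tilde\<close>. Where \<open>T\<close> vanishes the discriminant is at most zero, so that zero
  lies between \<open>\<alpha>\<^sub>1\<close> and \<open>\<alpha>\<^sub>2\<close>, and the two conditions together amount to \<open>t \<ge> \<alpha>\<^sub>2\<close>.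
\<close>

section \<open>Eigenvalues of a linear map that exchanges two planes\<close>

text \<open>The first components are 0 because the equations for \<open>x$1\<close> and
  \<open>y$1\<close> contain only products of coordinates that vanish at
  \<open>M1 \<alpha> \<beta>\<close>, and so have no linear part there.\<close>

definition block_map :: "real ^ 2 ^ 2 \<Rightarrow> real ^ 2 ^ 2 \<Rightarrow> so4 \<Rightarrow> so4" where
  "block_map A B v = (let x = fst v; y = snd v in
     (vector [0, A$1$1 * x$3 + A$1$2 * y$3, B$1$1 * x$2 + B$1$2 * y$2],
      vector [0, A$2$1 * x$3 + A$2$2 * y$3, B$2$1 * x$2 + B$2$2 * y$2]))"

text \<open>From left to right, multiply by the adjugate matrix. Conversely, a nonzero row
  \<open>(p, q)\<close> annihilates \<open>(q, - p)\<close>, and by the vanishing determinant so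
  does the other row.\<close>

lemma kernel_2x2:
  fixes p q r s :: "'a::field"
  shows "(\<exists>x y. (x \<noteq> 0 \<or> y \<noteq> 0) \<and> p * x + q * y = 0 \<and> r * x + s * y = 0) \<longleftrightarrow> p * s - q * r = 0"
proof
  assume "\<exists>x y. (x \<noteq> 0 \<or> y \<noteq> 0) \<and> p * x + q * y = 0 \<and> r * x + s * y = 0"
  then obtain x y where xy: "x \<noteq> 0 \<or> y \<noteq> 0" "p * x + q * y = 0" "r * x + s * y = 0" by blast
  have "(p * s - q * r) * x = s * (p * x + q * y) - q * (r * x + s * y)"
    "(p * s - q * r) * y = p * (r * x + s * y) - r * (p * x + q * y)"
    by (simp_all add: algebra_simps)
  then show "p * s - q * r = 0" using xy by auto
next
  assume det: "p * s - q * r = 0"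
  show "\<exists>x y. (x \<noteq> 0 \<or> y \<noteq> 0) \<and> p * x + q * y = 0 \<and> r * x + s * y = 0"
  proof (cases "p = 0 \<and> q = 0")
    case True
    then show ?thesis
    proof (cases "r = 0 \<and> s = 0")
      case True
      with \<open>p = 0 \<and> q = 0\<close> show ?thesis by (intro exI[of _ 1]) auto
    next
      case False
      with \<open>p = 0 \<and> q = 0\<close> show ?thesis
        by (intro exI[of _ s] exI[of _ "- r"]) (auto simp: algebra_simps)
    qed
  next
    case False
    with det show ?thesis
      by (intro exI[of _ q] exI[of _ "- p"]) (auto simp: algebra_simps)
  qed
qed

text \<open>The pair \<open>(u, w)\<close> in \<open>eigenvalue_on\<close> is merged into one
  complex vector with real part \<open>u\<close> and imaginary part \<open>w\<close>. The first
  coordinates drop out, since both sides are 0 there.\<close>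

lemma eigenvalue_on_block_map_complex:
  fixes \<mu> :: complex
  shows "eigenvalue_on (block_map A B) {v. fst v $ 1 = 0 \<and> snd v $ 1 = 0} \<mu> \<longleftrightarrow>
     (\<exists>(x2::complex) (x3::complex) (y2::complex) (y3::complex). \<not> (x2 = 0 \<and> x3 = 0 \<and> y2 = 0 \<and> y3 = 0) \<and>
        \<mu> * x2 = A$1$1 * x3 + A$1$2 * y3 \<and> \<mu> * y2 = A$2$1 * x3 + A$2$2 * y3 \<and>
        \<mu> * x3 = B$1$1 * x2 + B$1$2 * y2 \<and> \<mu> * y3 = B$2$1 * x2 + B$2$2 * y2)"
  (is "?L \<longleftrightarrow> ?R")
proof
  assume ?L
  then obtain u w where "fst u $ 1 = 0" "snd u $ 1 = 0" "fst w $ 1 = 0" "snd w $ 1 = 0"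
    and nz: "(u, w) \<noteq> (0, 0)"
    and "block_map A B u = Re \<mu> *\<^sub>R u - Im \<mu> *\<^sub>R w" "block_map A B w = Re \<mu> *\<^sub>R w + Im \<mu> *\<^sub>R u"
    unfolding eigenvalue_on_def by blast
  then show ?R
    by - (rule exI[of _ "Complex (fst u $ 2) (fst w $ 2)"], rule exI[of _ "Complex (fst u $ 3) (fst w $ 3)"],
        rule exI[of _ "Complex (snd u $ 2) (snd w $ 2)"], rule exI[of _ "Complex (snd u $ 3) (snd w $ 3)"],
        auto simp: block_map_def Let_def prod_eq_iff vec_eq_iff forall_3 complex_eq_iff)
next
  assume ?R
  then obtain x2 x3 y2 y3 :: complex where nz: "\<not> (x2 = 0 \<and> x3 = 0 \<and> y2 = 0 \<and> y3 = 0)"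
    and e: "\<mu> * x2 = A$1$1 * x3 + A$1$2 * y3" "\<mu> * y2 = A$2$1 * x3 + A$2$2 * y3"
    "\<mu> * x3 = B$1$1 * x2 + B$1$2 * y2" "\<mu> * y3 = B$2$1 * x2 + B$2$2 * y2"
    by blast
  define u :: so4 where "u = (vector [0, Re x2, Re x3], vector [0, Re y2, Re y3])"
  define w :: so4 where "w = (vector [0, Im x2, Im x3], vector [0, Im y2, Im y3])"
  have "u \<in> {v. fst v $ 1 = 0 \<and> snd v $ 1 = 0}" "w \<in> {v. fst v $ 1 = 0 \<and> snd v $ 1 = 0}"
    by (simp_all add: u_def w_def)
  moreover have "(u, w) \<noteq> (0, 0)"
    using nz unfolding complex_eq_iff u_def w_def prod_eq_iff vec_eq_iff forall_3
    by (simp only: fst_conv snd_conv vector_3 zero_index fst_zero snd_zero complex.sel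
        zero_complex.sel simp_thms) blast
  moreover have "block_map A B u = Re \<mu> *\<^sub>R u - Im \<mu> *\<^sub>R w"
    using arg_cong[OF e(1), of Re] arg_cong[OF e(2), of Re] arg_cong[OF e(3), of Re] arg_cong[OF e(4), of Re]
    by (simp add: u_def w_def block_map_def Let_def prod_eq_iff vec_eq_iff forall_3)
  moreover have "block_map A B w = Re \<mu> *\<^sub>R w + Im \<mu> *\<^sub>R u"
    using arg_cong[OF e(1), of Im] arg_cong[OF e(2), of Im] arg_cong[OF e(3), of Im] arg_cong[OF e(4), of Im]
    by (simp add: u_def w_def block_map_def Let_def prod_eq_iff vec_eq_iff forall_3)
  ultimately show ?L unfolding eigenvalue_on_def by blast
qed

text \<open>Eliminating \<open>x3\<close> and \<open>y3\<close> leaves \<open>A ** B\<close> acting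
  on \<open>(x2, y2)\<close> with eigenvalue \<open>\<mu>\<^sup>2\<close>, and the quartic is the
  characteristic polynomial of \<open>A ** B\<close> at that value. Division by \<mu> reverses the
  elimination. The eigenvalue 0 can be left aside because its real part is 0.\<close>

lemma eigenvalue_on_block_map:
  assumes "\<mu> \<noteq> 0"
  shows "eigenvalue_on (block_map A B) {v. fst v $ 1 = 0 \<and> snd v $ 1 = 0} \<mu> \<longleftrightarrow>
    (\<mu>\<^sup>2)\<^sup>2 - of_real (trace (A ** B)) * \<mu>\<^sup>2 + of_real (det (A ** B)) = 0"
proof -
  define N where "N i j = complex_of_real ((A ** B) $ i $ j)" for i j
  have N: "N i j = of_real (A$i$1) * of_real (B$1$j) + of_real (A$i$2) * of_real (B$2$j)" for i j
    by (simp add: N_def matrix_matrix_mult_def sum_2)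
  have "eigenvalue_on (block_map A B) {v. fst v $ 1 = 0 \<and> snd v $ 1 = 0} \<mu> \<longleftrightarrow>
    (\<exists>x y. (x \<noteq> 0 \<or> y \<noteq> 0) \<and> (N 1 1 - \<mu>\<^sup>2) * x + N 1 2 * y = 0 \<and> N 2 1 * x + (N 2 2 - \<mu>\<^sup>2) * y = 0)"
    (is "?L \<longleftrightarrow> ?R")
  proof
    assume ?L
    then obtain x2 x3 y2 y3 :: complex
      where nz: "\<not> (x2 = 0 \<and> x3 = 0 \<and> y2 = 0 \<and> y3 = 0)"
      and e: "\<mu> * x2 = A$1$1 * x3 + A$1$2 * y3" "\<mu> * y2 = A$2$1 * x3 + A$2$2 * y3"
      "\<mu> * x3 = B$1$1 * x2 + B$1$2 * y2" "\<mu> * y3 = B$2$1 * x2 + B$2$2 * y2"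
      unfolding eigenvalue_on_block_map_complex by blast
    have "x2 \<noteq> 0 \<or> y2 \<noteq> 0" using nz e assms by auto
    moreover have "\<mu>\<^sup>2 * x2 = A$1$1 * (\<mu> * x3) + A$1$2 * (\<mu> * y3)"
      using arg_cong[OF e(1), of "\<lambda>z. \<mu> * z"] by (simp add: power2_eq_square algebra_simps)
    moreover have "\<mu>\<^sup>2 * y2 = A$2$1 * (\<mu> * x3) + A$2$2 * (\<mu> * y3)"
      using arg_cong[OF e(2), of "\<lambda>z. \<mu> * z"] by (simp add: power2_eq_square algebra_simps)
    ultimately show ?R
      unfolding e(3,4) N by - (rule exI[of _ x2], rule exI[of _ y2], simp add: algebra_simps)
  next
    assume ?R
    then obtain x y where nz: "x \<noteq> 0 \<or> y \<noteq> 0"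
      and xy: "(N 1 1 - \<mu>\<^sup>2) * x + N 1 2 * y = 0" "N 2 1 * x + (N 2 2 - \<mu>\<^sup>2) * y = 0"
      by blast
    have e: "\<mu>\<^sup>2 * x = N 1 1 * x + N 1 2 * y" "\<mu>\<^sup>2 * y = N 2 1 * x + N 2 2 * y"
      using xy by (simp_all add: algebra_simps)
    \<comment> \<open>The third and fourth equations determine \<open>x3\<close> and
      \<open>y3\<close> from the kernel vector.\<close>
    define x3 where "x3 = (B$1$1 * x + B$1$2 * y) / \<mu>"
    define y3 where "y3 = (B$2$1 * x + B$2$2 * y) / \<mu>"
    have B: "\<mu> * x3 = B$1$1 * x + B$1$2 * y" "\<mu> * y3 = B$2$1 * x + B$2$2 * y"
      using assms by (simp_all add: x3_def y3_def)
    have "\<mu> * (\<mu> * x) = A$1$1 * (\<mu> * x3) + A$1$2 * (\<mu> * y3)"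
      "\<mu> * (\<mu> * y) = A$2$1 * (\<mu> * x3) + A$2$2 * (\<mu> * y3)"
      using e unfolding B N by (simp_all add: power2_eq_square algebra_simps)
    then have "\<mu> * (\<mu> * x) = \<mu> * (A$1$1 * x3 + A$1$2 * y3)"
      "\<mu> * (\<mu> * y) = \<mu> * (A$2$1 * x3 + A$2$2 * y3)"
      by (simp_all add: algebra_simps)
    then have "\<mu> * x = A$1$1 * x3 + A$1$2 * y3" "\<mu> * y = A$2$1 * x3 + A$2$2 * y3"
      using assms by (simp_all only: mult_cancel_left simp_thms)
    then have "\<not> (x = 0 \<and> x3 = 0 \<and> y = 0 \<and> y3 = 0) \<and>
        \<mu> * x = A$1$1 * x3 + A$1$2 * y3 \<and> \<mu> * y = A$2$1 * x3 + A$2$2 * y3 \<and>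
        \<mu> * x3 = B$1$1 * x + B$1$2 * y \<and> \<mu> * y3 = B$2$1 * x + B$2$2 * y"
      using nz B by blast
    then show ?L
      unfolding eigenvalue_on_block_map_complex by (intro exI)
  qed
  also have "\<dots> \<longleftrightarrow> (N 1 1 - \<mu>\<^sup>2) * (N 2 2 - \<mu>\<^sup>2) - N 1 2 * N 2 1 = 0"
    by (rule kernel_2x2)
  also have "(N 1 1 - \<mu>\<^sup>2) * (N 2 2 - \<mu>\<^sup>2) - N 1 2 * N 2 1 =
    (\<mu>\<^sup>2)\<^sup>2 - of_real (trace (A ** B)) * \<mu>\<^sup>2 + of_real (det (A ** B))"
    unfolding N_def trace_def det_2 sum_2 by (simp add: power2_eq_square algebra_simps)
  finally show ?thesis .
qed

section \<open>Real parts of the roots of the biquadratic equation\<close>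

text \<open>Principal square roots have nonnegative real part; take one of the discriminant and one
  of the resulting value of \<open>\<mu>\<^sup>2\<close>. If \<open>Re \<mu>\<close> were 0, then
  \<open>\<mu>\<^sup>2\<close> and hence \<open>r\<close> would be real, and \<open>r\<close> would
  be nonnegative. This forces both \<open>T \<le> 0\<close> and a nonnegative discriminant.\<close>

lemma biquadratic_root_Re_pos:
  fixes T D :: real
  assumes "\<not> (T\<^sup>2 - 4 * D \<ge> 0 \<and> T \<le> 0)"
  shows "\<exists>\<mu>::complex. Re \<mu> > 0 \<and> (\<mu>\<^sup>2)\<^sup>2 - of_real T * \<mu>\<^sup>2 + of_real D = 0"
proof -
  define r where "r = csqrt (of_real (T\<^sup>2 - 4 * D))"
  define \<mu> where "\<mu> = csqrt ((of_real T + r) / 2)"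
  have sq: "2 * \<mu>\<^sup>2 = of_real T + r" "r\<^sup>2 = of_real (T\<^sup>2 - 4 * D)"
    unfolding \<mu>_def r_def power2_csqrt by simp_all
  have "4 * ((\<mu>\<^sup>2)\<^sup>2 - of_real T * \<mu>\<^sup>2 + of_real D) =
      (2 * \<mu>\<^sup>2 - of_real T)\<^sup>2 - of_real (T\<^sup>2 - 4 * D)"
    by (simp add: power2_eq_square algebra_simps)
  also have "\<dots> = 0" unfolding sq(1) by (simp add: sq(2))
  finally have "(\<mu>\<^sup>2)\<^sup>2 - of_real T * \<mu>\<^sup>2 + of_real D = 0"
    by (simp only: mult_eq_0_iff) simp
  moreover have "Re \<mu> > 0"
  proof (rule ccontr)
    assume "\<not> Re \<mu> > 0"
    then have re: "Re \<mu> = 0" using csqrt_principal[of "(of_real T + r) / 2"] by (auto simp: \<mu>_def)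
    have r: "r = of_real (- 2 * (Im \<mu>)\<^sup>2 - T)"
      using sq(1) re by (simp add: complex_eq_iff power2_eq_square)
    have "Re r \<ge> 0" using csqrt_principal unfolding r_def by (metis less_eq_real_def)
    then have "T \<le> - 2 * (Im \<mu>)\<^sup>2" unfolding r by simp
    moreover have "complex_of_real ((- 2 * (Im \<mu>)\<^sup>2 - T)\<^sup>2) = of_real (T\<^sup>2 - 4 * D)"
      using sq(2) unfolding r of_real_power .
    then have "T\<^sup>2 - 4 * D = (- 2 * (Im \<mu>)\<^sup>2 - T)\<^sup>2"
      by (simp only: of_real_eq_iff)
    ultimately show False using assms zero_le_power2[of "Im \<mu>"] zero_le_power2[of "- 2 * (Im \<mu>)\<^sup>2 - T"]
      by linarith
  qed
  ultimately show ?thesis by blast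
qed

text \<open>With \<open>d\<close> the root of the discriminant, \<open>D \<ge> 0\<close> gives
  \<open>d \<le> - T\<close>. Both candidates \<open>(T + d) / 2\<close> and
  \<open>(T - d) / 2\<close> for \<open>\<mu>\<^sup>2\<close> are therefore real and at most
  0.\<close>

lemma biquadratic_root_Re_zero:
  fixes T D :: real and \<mu> :: complex
  assumes "T\<^sup>2 - 4 * D \<ge> 0" "T \<le> 0" "D \<ge> 0"
    and root: "(\<mu>\<^sup>2)\<^sup>2 - of_real T * \<mu>\<^sup>2 + of_real D = 0"
  shows "Re \<mu> = 0"
proof -
  define d where "d = sqrt (T\<^sup>2 - 4 * D)"
  have d1: "d\<^sup>2 = T\<^sup>2 - 4 * D" and d2: "d \<ge> 0" using assms(1) by (simp_all add: d_def)
  have "d\<^sup>2 \<le> (- T)\<^sup>2" unfolding d1 power2_minus using assms(3) by linarith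
  then have d3: "d \<le> - T" using assms(2) by (intro power2_le_imp_le[of d "- T"]) linarith+
  have "(2 * \<mu>\<^sup>2 - of_real T)\<^sup>2 - of_real (d\<^sup>2) = 4 * ((\<mu>\<^sup>2)\<^sup>2 - of_real T * \<mu>\<^sup>2 + of_real D)"
    unfolding d1 by (simp add: power2_eq_square algebra_simps)
  then have "(2 * \<mu>\<^sup>2 - of_real T)\<^sup>2 = (of_real d)\<^sup>2"
    by (simp only: root mult_zero_right right_minus_eq of_real_power)
  then have "2 * \<mu>\<^sup>2 - of_real T = of_real d \<or> 2 * \<mu>\<^sup>2 - of_real T = - of_real d"
    by (rule power2_eq_iff[THEN iffD1])
  then have "Im (\<mu>\<^sup>2) = 0 \<and> Re (\<mu>\<^sup>2) \<le> 0"
  proof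
    assume "2 * \<mu>\<^sup>2 - of_real T = of_real d"
    from arg_cong[OF this, of Re] arg_cong[OF this, of Im]
    have "2 * Re (\<mu>\<^sup>2) - T = d" "2 * Im (\<mu>\<^sup>2) = 0"
      by (simp_all del: Re_power2 Im_power2)
    then show ?thesis using d3 by simp
  next
    assume "2 * \<mu>\<^sup>2 - of_real T = - of_real d"
    from arg_cong[OF this, of Re] arg_cong[OF this, of Im]
    have "2 * Re (\<mu>\<^sup>2) - T = - d" "2 * Im (\<mu>\<^sup>2) = 0"
      by (simp_all del: Re_power2 Im_power2)
    then show ?thesis using d2 assms(2) by simp
  qed
  then have "Re \<mu> = 0 \<or> Im \<mu> = 0" "Re \<mu> * Re \<mu> \<le> Im \<mu> * Im \<mu>"
    by (auto simp: power2_eq_square)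
  then show ?thesis by (auto simp: mult_le_0_iff)
qed

section \<open>Linearization and tangent space at \<open>M1\<close>\<close>

text \<open>As a sum of scaled constant vectors, a \<open>vector\<close> term falls under the
  standard differentiation rules.\<close>

lemma vector_3_axis:
  "(vector [p, q, r] :: real ^ 3) = p *\<^sub>R axis 1 1 + q *\<^sub>R axis 2 1 + r *\<^sub>R axis 3 1"
  by (simp add: vec_eq_iff forall_3 axis_def)

text \<open>The Jacobian block from \<open>(x$3, y$3)\<close> to the components 2 of the vector
  field; \<open>lin_B\<close> is the block from \<open>(x$2, y$2)\<close> to the components
  3.\<close>

definition lin_A :: "real ^ 4 \<Rightarrow> real \<Rightarrow> real \<Rightarrow> real ^ 2 ^ 2" where
  "lin_A l \<alpha> \<beta> = (let \<kappa> = (\<lambda>i j. 1 / (l$i + l$j)) in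
     vector [vector [(\<kappa> 2 3 - \<kappa> 1 2) * \<alpha>, (\<kappa> 1 4 - \<kappa> 3 4) * \<beta>],
             vector [(\<kappa> 1 4 - \<kappa> 1 2) * \<beta>, (\<kappa> 2 3 - \<kappa> 3 4) * \<alpha>]])"

definition lin_B :: "real ^ 4 \<Rightarrow> real \<Rightarrow> real \<Rightarrow> real ^ 2 ^ 2" where
  "lin_B l \<alpha> \<beta> = (let \<kappa> = (\<lambda>i j. 1 / (l$i + l$j)) in
     vector [vector [(\<kappa> 1 3 - \<kappa> 2 3) * \<alpha>, (\<kappa> 2 4 - \<kappa> 1 4) * \<beta>],
             vector [(\<kappa> 1 3 - \<kappa> 1 4) * \<beta>, (\<kappa> 2 4 - \<kappa> 2 3) * \<alpha>]])"

lemma frechet_derivative_rigid_body_M1: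
  "frechet_derivative (rigid_body l) (at (M1 \<alpha> \<beta>)) = block_map (lin_A l \<alpha> \<beta>) (lin_B l \<alpha> \<beta>)"
proof -
  have nth: "((\<lambda>z::so4. fst z $ i) has_derivative (\<lambda>h. fst h $ i)) F"
    "((\<lambda>z::so4. snd z $ i) has_derivative (\<lambda>h. snd h $ i)) F" for i F
    by (auto intro!: bounded_linear.has_derivative[OF bounded_linear_vec_nth] derivative_eq_intros)
  have "(rigid_body l has_derivative block_map (lin_A l \<alpha> \<beta>) (lin_B l \<alpha> \<beta>)) (at (M1 \<alpha> \<beta>))"
    unfolding rigid_body_def[abs_def] Let_def vector_3_axis
    by (rule has_derivative_eq_rhs, (rule derivative_intros nth)+)
      (simp add: fun_eq_iff block_map_def lin_A_def lin_B_def M1_def Let_def prod_eq_iff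
         vec_eq_iff forall_3 axis_def algebra_simps)
  then show ?thesis by (rule frechet_derivative_at[symmetric])
qed

text \<open>The differentials of the Casimir functions at this point involve only \<open>x$1\<close>
  and \<open>y$1\<close>, with coefficients \<open>(\<alpha>, \<beta>)\<close> and
  \<open>(\<beta>, \<alpha>)\<close>. Their determinant is
  \<open>\<alpha>\<^sup>2 - \<beta>\<^sup>2\<close>.\<close>

lemma orbit_tangent_M1:
  assumes "\<alpha>\<^sup>2 \<noteq> \<beta>\<^sup>2"
  shows "orbit_tangent (M1 \<alpha> \<beta>) = {v. fst v $ 1 = 0 \<and> snd v $ 1 = 0}"
proof -
  have "\<alpha> * x + \<beta> * y = 0 \<and> \<beta> * x + \<alpha> * y = 0 \<longleftrightarrow> x = 0 \<and> y = 0" for x y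
  proof
    assume e: "\<alpha> * x + \<beta> * y = 0 \<and> \<beta> * x + \<alpha> * y = 0"
    have "(\<alpha>\<^sup>2 - \<beta>\<^sup>2) * x = \<alpha> * (\<alpha> * x + \<beta> * y) - \<beta> * (\<beta> * x + \<alpha> * y)"
      "(\<alpha>\<^sup>2 - \<beta>\<^sup>2) * y = \<alpha> * (\<beta> * x + \<alpha> * y) - \<beta> * (\<alpha> * x + \<beta> * y)"
      by (simp_all add: power2_eq_square algebra_simps)
    then show "x = 0 \<and> y = 0" using e assms by auto
  qed auto
  then show ?thesis
    by (auto simp: orbit_tangent_def frechet_derivative_casimir M1_def inner_prod_def inner_axis'
        simp del: mult_eq_0_iff)
qed

lemma M1_stability_trace_det:
  fixes l :: "real ^ 4"
  assumes "\<alpha>\<^sup>2 \<noteq> \<beta>\<^sup>2"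
  defines "T \<equiv> trace (lin_A l \<alpha> \<beta> ** lin_B l \<alpha> \<beta>)" and "D \<equiv> det (lin_A l \<alpha> \<beta> ** lin_B l \<alpha> \<beta>)"
  shows "\<not> (T\<^sup>2 - 4 * D \<ge> 0 \<and> T \<le> 0) \<Longrightarrow> spectrally_unstable (rigid_body l) (M1 \<alpha> \<beta>)"
    and "T\<^sup>2 - 4 * D \<ge> 0 \<Longrightarrow> T \<le> 0 \<Longrightarrow> D \<ge> 0 \<Longrightarrow> spectrally_stable (rigid_body l) (M1 \<alpha> \<beta>)"
proof -
  have ev: "eigenvalue_on (frechet_derivative (rigid_body l) (at (M1 \<alpha> \<beta>))) (orbit_tangent (M1 \<alpha> \<beta>)) \<mu>
      \<longleftrightarrow> (\<mu>\<^sup>2)\<^sup>2 - of_real T * \<mu>\<^sup>2 + of_real D = 0" if "\<mu> \<noteq> 0" for \<mu>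
    using eigenvalue_on_block_map[OF that]
    by (simp add: frechet_derivative_rigid_body_M1 orbit_tangent_M1[OF assms(1)] T_def D_def)
  show "spectrally_unstable (rigid_body l) (M1 \<alpha> \<beta>)" if neg: "\<not> (T\<^sup>2 - 4 * D \<ge> 0 \<and> T \<le> 0)"
  proof -
    obtain \<mu> :: complex where "Re \<mu> > 0" "(\<mu>\<^sup>2)\<^sup>2 - of_real T * \<mu>\<^sup>2 + of_real D = 0"
      using biquadratic_root_Re_pos[OF neg] by blast
    moreover from this have "\<mu> \<noteq> 0" by auto
    ultimately show ?thesis unfolding spectrally_unstable_def using ev by blast
  qed
  \<comment> \<open>The characterization \<open>ev\<close> covers nonzero \<mu>; for
    \<open>\<mu> = 0\<close> the real part is 0 at once.\<close>
  show "spectrally_stable (rigid_body l) (M1 \<alpha> \<beta>)" if "T\<^sup>2 - 4 * D \<ge> 0" "T \<le> 0" "D \<ge> 0"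
    unfolding spectrally_stable_def using ev biquadratic_root_Re_zero[OF that]
    by (metis zero_complex.sel(1))
qed

section \<open>Trace, determinant and discriminant as functions of the parameters\<close>

text \<open>The factor \<open>E\<close> clears all denominators except the squares of
  \<open>l$1 + l$4\<close> and \<open>l$2 + l$3\<close>, which are absorbed into \<open>X\<close>
  and \<open>Y\<close>. The square in the determinant arises because \<open>lin_A\<close> and
  \<open>lin_B\<close> each contribute one factor \<open>X - Y\<close>.\<close>

lemma
  fixes l :: "real ^ 4" and \<alpha> \<beta> :: real
  assumes pos: "\<And>i j. i \<noteq> j \<Longrightarrow> l$i + l$j > 0"
  defines "E \<equiv> (l$1 + l$2) * (l$1 + l$3) * (l$2 + l$4) * (l$3 + l$4)"
    and "X \<equiv> \<beta>\<^sup>2 / (l$1 + l$4)\<^sup>2" and "Y \<equiv> \<alpha>\<^sup>2 / (l$2 + l$3)\<^sup>2"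
  shows trace_lin: "E * trace (lin_A l \<alpha> \<beta> ** lin_B l \<alpha> \<beta>) =
      ((l$1 - l$3) * (l$3 - l$4) * (l$1 + l$2) * (l$2 + l$4) +
       (l$2 - l$4) * (l$1 - l$2) * (l$1 + l$3) * (l$3 + l$4)) * X -
      ((l$1 - l$3) * (l$1 - l$2) * (l$3 + l$4) * (l$2 + l$4) +
       (l$2 - l$4) * (l$3 - l$4) * (l$1 + l$2) * (l$1 + l$3)) * Y" (is ?T)
    and det_lin: "E * det (lin_A l \<alpha> \<beta> ** lin_B l \<alpha> \<beta>) =
      (l$1 - l$2) * (l$3 - l$4) * (l$1 - l$3) * (l$2 - l$4) * (X - Y)\<^sup>2" (is ?D)
proof -
  define d where "d i j = l$i + l$j" for i j
  have nz: "d i j \<noteq> 0" if "i \<noteq> j" for i j using pos[OF that] by (simp add: d_def)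
  \<comment> \<open>The shared index can stand first or second in either sum, hence four
    forms.\<close>
  have diff: "1 / d i j - 1 / d i k = (l$k - l$j) / (d i j * d i k)"
    "1 / d j i - 1 / d i k = (l$k - l$j) / (d j i * d i k)"
    "1 / d i j - 1 / d k i = (l$k - l$j) / (d i j * d k i)"
    "1 / d j i - 1 / d k i = (l$k - l$j) / (d j i * d k i)"
    if "i \<noteq> j" "i \<noteq> k" for i j k
    using nz[OF that(1)] nz[OF that(2)] nz[OF that(1)[symmetric]] nz[OF that(2)[symmetric]]
    by (simp_all add: d_def field_simps)
  have A: "lin_A l \<alpha> \<beta> $ 1 $ 1 = (l$1 - l$3) / (d 2 3 * d 1 2) * \<alpha>"
    "lin_A l \<alpha> \<beta> $ 1 $ 2 = (l$3 - l$1) / (d 1 4 * d 3 4) * \<beta>"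
    "lin_A l \<alpha> \<beta> $ 2 $ 1 = (l$2 - l$4) / (d 1 4 * d 1 2) * \<beta>"
    "lin_A l \<alpha> \<beta> $ 2 $ 2 = (l$4 - l$2) / (d 2 3 * d 3 4) * \<alpha>"
    by (simp_all add: lin_A_def Let_def d_def[symmetric] diff)
  have B: "lin_B l \<alpha> \<beta> $ 1 $ 1 = (l$2 - l$1) / (d 1 3 * d 2 3) * \<alpha>"
    "lin_B l \<alpha> \<beta> $ 1 $ 2 = (l$1 - l$2) / (d 2 4 * d 1 4) * \<beta>"
    "lin_B l \<alpha> \<beta> $ 2 $ 1 = (l$4 - l$3) / (d 1 3 * d 1 4) * \<beta>"
    "lin_B l \<alpha> \<beta> $ 2 $ 2 = (l$3 - l$4) / (d 2 4 * d 2 3) * \<alpha>"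
    by (simp_all add: lin_B_def Let_def d_def[symmetric] diff)
  note n = nz[of 1 2] nz[of 1 3] nz[of 1 4] nz[of 2 3] nz[of 2 4] nz[of 3 4]
  have detA: "d 1 2 * d 3 4 * det (lin_A l \<alpha> \<beta>) = (l$1 - l$3) * (l$2 - l$4) * (X - Y)"
    unfolding det_2 A X_def Y_def d_def[symmetric] using n
    by (simp add: divide_simps power2_eq_square) (simp add: algebra_simps)
  have detB: "d 1 3 * d 2 4 * det (lin_B l \<alpha> \<beta>) = (l$1 - l$2) * (l$3 - l$4) * (X - Y)"
    unfolding det_2 B X_def Y_def d_def[symmetric] using n
    by (simp add: divide_simps power2_eq_square) (simp add: algebra_simps)
  have "E * det (lin_A l \<alpha> \<beta> ** lin_B l \<alpha> \<beta>) =
      (d 1 2 * d 3 4 * det (lin_A l \<alpha> \<beta>)) * (d 1 3 * d 2 4 * det (lin_B l \<alpha> \<beta>))"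
    unfolding det_mul E_def d_def by (simp only: mult_ac)
  then show ?D unfolding detA detB by (simp add: power2_eq_square mult_ac)
  show ?T
    unfolding trace_def matrix_matrix_mult_def sum_2 X_def Y_def E_def d_def[symmetric]
    using n by (simp add: A B divide_simps power2_eq_square) (simp add: algebra_simps)
qed

text \<open>Here \<open>p\<close> and \<open>q\<close> are the coefficients of
  \<open>trace_lin\<close>, and \<open>r\<close> is \<open>E\<close> times the coefficient of
  \<open>det_lin\<close>. Expanded in powers of \<open>t\<close>, all three coefficients of the
  right-hand side share the factor \<open>4 * e\<^sup>2\<close> with
  \<open>e = l$2 * l$3 - l$1 * l$4\<close>; it goes into \<open>k\<close>.\<close>

lemma discriminant_eq_f_tilde:
  fixes l :: "real ^ 4"
  assumes pos: "\<And>i j. i \<noteq> j \<Longrightarrow> l$i + l$j > 0"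
  defines "p \<equiv> (l$1 - l$3) * (l$3 - l$4) * (l$1 + l$2) * (l$2 + l$4) +
       (l$2 - l$4) * (l$1 - l$2) * (l$1 + l$3) * (l$3 + l$4)"
    and "q \<equiv> (l$1 - l$3) * (l$1 - l$2) * (l$3 + l$4) * (l$2 + l$4) +
       (l$2 - l$4) * (l$3 - l$4) * (l$1 + l$2) * (l$1 + l$3)"
    and "r \<equiv> ((l$1)\<^sup>2 - (l$2)\<^sup>2) * ((l$3)\<^sup>2 - (l$4)\<^sup>2) * ((l$1)\<^sup>2 - (l$3)\<^sup>2) * ((l$2)\<^sup>2 - (l$4)\<^sup>2)"
    and "k \<equiv> (2 * (l$2 * l$3 - l$1 * l$4) / ((l$1 + l$4) * (l$2 + l$3)))\<^sup>2"
  shows "k * f_tilde l t = (p / (l$1 + l$4)\<^sup>2 - q / (l$2 + l$3)\<^sup>2 * t)\<^sup>2 -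
    4 * r * (1 / (l$1 + l$4)\<^sup>2 - 1 / (l$2 + l$3)\<^sup>2 * t)\<^sup>2"
proof -
  define m where "m = l$1 + l$4"
  define n where "n = l$2 + l$3"
  define e where "e = l$2 * l$3 - l$1 * l$4"
  define B where "B = ((l$1)\<^sup>2 - (l$2)\<^sup>2) * ((l$3)\<^sup>2 - (l$4)\<^sup>2) +
      ((l$1)\<^sup>2 - (l$3)\<^sup>2) * ((l$2)\<^sup>2 - (l$4)\<^sup>2)"
  have mn: "m \<noteq> 0" "n \<noteq> 0" using pos[of 1 4] pos[of 2 3] by (simp_all add: m_def n_def)
  have U: "p\<^sup>2 - 4 * r = (2 * e * m * (l$2 - l$3))\<^sup>2"
    unfolding p_def r_def m_def e_def by algebra
  have S: "q\<^sup>2 - 4 * r = (2 * e * n * (l$1 - l$4))\<^sup>2"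
    unfolding q_def r_def n_def e_def by algebra
  have T: "4 * r - p * q = - 4 * e\<^sup>2 * B"
    unfolding p_def q_def r_def e_def B_def by algebra
  have "(p / m\<^sup>2 - q / n\<^sup>2 * t)\<^sup>2 - 4 * r * (1 / m\<^sup>2 - 1 / n\<^sup>2 * t)\<^sup>2 =
      (p\<^sup>2 - 4 * r) / (m\<^sup>2)\<^sup>2 + 2 * ((4 * r - p * q) / (m\<^sup>2 * n\<^sup>2)) * t + (q\<^sup>2 - 4 * r) / (n\<^sup>2)\<^sup>2 * t\<^sup>2"
    using mn by (simp add: divide_simps power2_eq_square) (simp add: algebra_simps)
  also have "\<dots> = (2 * e / (m * n))\<^sup>2 *
      ((m * (l$1 - l$4))\<^sup>2 * t\<^sup>2 + - 2 * B * t + (n * (l$2 - l$3))\<^sup>2)"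
    unfolding U S T using mn by (simp add: divide_simps power2_eq_square) (simp add: algebra_simps)
  also have "(m * (l$1 - l$4))\<^sup>2 * t\<^sup>2 + - 2 * B * t + (n * (l$2 - l$3))\<^sup>2 = f_tilde l t"
    unfolding f_tilde_def Let_def B_def m_def n_def
    by (simp add: power2_eq_square[of "l$_"] square_diff_square_factored)
  finally show ?thesis by (simp add: m_def n_def e_def k_def)
qed

section \<open>The roots of \<open>f_tilde\<close>\<close>

text \<open>When \<open>l$2 * l$3 = l$1 * l$4\<close> the last summand vanishes, and both roots can
  be read off the product.\<close>

lemma f_tilde_eq_product:
  "f_tilde l t = ((l$1 + l$4)\<^sup>2 * t - (l$2 + l$3)\<^sup>2) * ((l$1 - l$4)\<^sup>2 * t - (l$2 - l$3)\<^sup>2) +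
     4 * (l$2 * l$3 - l$1 * l$4)\<^sup>2 * t"
  unfolding f_tilde_def Let_def by (simp add: power2_eq_square algebra_simps)

text \<open>
  If \<open>\<lambda>\<^sub>2 \<lambda>\<^sub>3 = \<lambda>\<^sub>1 \<lambda>\<^sub>4\<close>, the factor \<open>k\<close> in \<open>discriminant_eq_f_tilde\<close> is zero, so the discriminant vanishes identically and carries
  no information on the roots of \<open>f_tilde\<close>; they are then found explicitly.
\<close>

lemma f_tilde_larger_root_degenerate:
  fixes l :: "real ^ 4"
  assumes "l$1 > l$2" "l$2 > l$3" "l$3 > l$4"
    and pos: "\<And>i j. i \<noteq> j \<Longrightarrow> l$i + l$j > 0"
    and roots: "\<alpha>1 < \<alpha>2" "{t. f_tilde l t = 0} = {\<alpha>1, \<alpha>2}"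
    and "l$2 * l$3 = l$1 * l$4"
  shows "\<alpha>2 = (l$2 + l$3)\<^sup>2 / (l$1 + l$4)\<^sup>2"
proof -
  define m where "m = l$1 + l$4"
  define n where "n = l$2 + l$3"
  define m' where "m' = l$1 - l$4"
  define n' where "n' = l$2 - l$3"
  have mn: "m > 0" "n > 0" "m' > 0" "n' > 0"
    using assms(1-3) pos[of 1 4] pos[of 2 3] by (simp_all add: m_def n_def m'_def n'_def)
  have "f_tilde l t = (m\<^sup>2 * t - n\<^sup>2) * (m'\<^sup>2 * t - n'\<^sup>2)" for t
    unfolding f_tilde_eq_product using assms(7) by (simp add: m_def n_def m'_def n'_def)
  then have "f_tilde l (n\<^sup>2 / m\<^sup>2) = 0" "f_tilde l (n'\<^sup>2 / m'\<^sup>2) = 0" using mn by simp_all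
  then have r: "n\<^sup>2 / m\<^sup>2 \<in> {\<alpha>1, \<alpha>2}" "n'\<^sup>2 / m'\<^sup>2 \<in> {\<alpha>1, \<alpha>2}"
    unfolding roots(2)[symmetric] by simp_all
  \<comment> \<open>To compare the two roots, note that \<open>n * m' - n' * m\<close> is twice
    \<open>l$1 * l$3 - l$2 * l$4\<close>, which is positive by inserting \<open>l$2 * l$3\<close> in
    between.\<close>
  have "l$3 > 0" "l$1 > 0" using assms(1-3) pos[of 3 4] by simp_all
  then have "l$1 * l$3 > l$2 * l$3" "l$2 * l$3 > l$2 * l$4" using assms(1-3) by simp_all
  then have "n' * m < n * m'" by (simp add: m_def n_def m'_def n'_def algebra_simps)
  then have "n' / m' < n / m" using mn by (simp add: divide_simps mult.commute)
  then have "(n' / m')\<^sup>2 < (n / m)\<^sup>2" using mn by (intro power_strict_mono) simp_all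
  then show ?thesis using r roots(1) unfolding power_divide m_def[symmetric] n_def[symmetric] by auto
qed

lemma f_tilde_factorization:
  fixes l :: "real ^ 4"
  assumes "\<alpha>1 < \<alpha>2" and roots: "{t. f_tilde l t = 0} = {\<alpha>1, \<alpha>2}"
  shows "f_tilde l t = ((l$1)\<^sup>2 - (l$4)\<^sup>2)\<^sup>2 * (t - \<alpha>1) * (t - \<alpha>2)"
proof -
  obtain S T U where f: "f_tilde l t = S * t\<^sup>2 + T * t + U" and S: "S = ((l$1)\<^sup>2 - (l$4)\<^sup>2)\<^sup>2" for t
    unfolding f_tilde_def Let_def by blast
  have e: "S * \<alpha>1\<^sup>2 + T * \<alpha>1 + U = 0" "S * \<alpha>2\<^sup>2 + T * \<alpha>2 + U = 0"
    using roots unfolding f by auto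
  \<comment> \<open>The difference of the two root equations gives the sum of the roots; either
    equation then gives their product.\<close>
  have "(\<alpha>1 - \<alpha>2) * (S * (\<alpha>1 + \<alpha>2) + T) = 0"
    using e by (simp add: power2_eq_square algebra_simps)
  then have T: "T = - S * (\<alpha>1 + \<alpha>2)" using assms(1) by auto
  have "U = S * \<alpha>1 * \<alpha>2" using e(1) unfolding T by (simp add: power2_eq_square algebra_simps)
  then show ?thesis unfolding f S[symmetric] T by (simp add: power2_eq_square algebra_simps)
qed

section \<open>From the sign conditions to the larger root\<close>

text \<open>At the zero \<open>t0\<close> of \<open>P - Q * t\<close> the discriminant is minus a
  nonnegative term, so \<open>t0\<close> lies between the roots. Beyond \<open>t0\<close> a
  nonnegative discriminant then means \<open>\<alpha>2 \<le> t\<close>, provided that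
  \<open>t0\<close> is not \<alpha>1 itself.\<close>

lemma above_larger_root_iff:
  fixes P Q R g h S \<alpha>1 \<alpha>2 t :: real
  assumes "Q > 0" "R \<ge> 0" "S > 0" "\<alpha>1 < \<alpha>2"
    and f: "\<And>t. (P - Q * t)\<^sup>2 - 4 * R * (g - h * t)\<^sup>2 = S * (t - \<alpha>1) * (t - \<alpha>2)"
  shows "(P - Q * t)\<^sup>2 - 4 * R * (g - h * t)\<^sup>2 \<ge> 0 \<and> P - Q * t \<le> 0 \<longleftrightarrow> \<alpha>2 \<le> t"
proof -
  define t0 where "t0 = P / Q"
  have P: "P = Q * t0" using assms(1) by (simp add: t0_def)
  have Pt: "P - Q * t \<le> 0 \<longleftrightarrow> t0 \<le> t" for t using assms(1) by (simp add: P)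
  have sign: "S * (t - \<alpha>1) * (t - \<alpha>2) \<ge> 0 \<longleftrightarrow> t \<le> \<alpha>1 \<or> \<alpha>2 \<le> t" for t
    using assms(3,4) by (auto simp: mult.assoc zero_le_mult_iff)
  have "R * (g - h * t0)\<^sup>2 \<ge> 0" using assms(2) by simp
  then have "S * ((t0 - \<alpha>1) * (t0 - \<alpha>2)) \<le> 0"
    using f[of t0] unfolding P by (simp add: mult.assoc)
  then have "(t0 - \<alpha>1) * (t0 - \<alpha>2) \<le> 0" using assms(3) by (simp add: mult_le_0_iff)
  then have t0: "\<alpha>1 \<le> t0" "t0 \<le> \<alpha>2" using assms(4) by (auto simp: mult_le_0_iff)
  \<comment> \<open>Otherwise \<open>t = \<alpha>1\<close> would satisfy both conditions. In that
    case the discriminant would be a constant multiple of \<open>(s - t0)\<^sup>2\<close>, which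
    cannot have a second root.\<close>
  have "t0 \<noteq> \<alpha>1"
  proof
    assume eq: "t0 = \<alpha>1"
    then have z: "R * (g - h * t0)\<^sup>2 = 0" using f[of t0] unfolding P by simp
    have R: "R * (g - h * s)\<^sup>2 = R * h\<^sup>2 * (s - t0)\<^sup>2" for s
    proof (cases "R = 0")
      case False
      then have "g = h * t0" using z by simp
      then show ?thesis by (simp add: power2_eq_square algebra_simps)
    qed simp
    have f': "S * (s - \<alpha>1) * (s - \<alpha>2) = (Q\<^sup>2 - 4 * (R * h\<^sup>2)) * (s - t0)\<^sup>2" for s
    proof -
      have "S * (s - \<alpha>1) * (s - \<alpha>2) = (Q * (t0 - s))\<^sup>2 - 4 * (R * (g - h * s)\<^sup>2)"
        unfolding f[of s, symmetric] P by (simp add: algebra_simps)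
      also have "\<dots> = (Q\<^sup>2 - 4 * (R * h\<^sup>2)) * (s - t0)\<^sup>2"
        unfolding R by (simp add: power2_eq_square algebra_simps)
      finally show ?thesis .
    qed
    \<comment> \<open>The root \<alpha>2 forces the constant to be 0; the point
      \<open>\<alpha>2 + 1\<close>, beyond both roots, then gives the contradiction.\<close>
    have "Q\<^sup>2 - 4 * (R * h\<^sup>2) = 0" using f'[of \<alpha>2] eq assms(4) by simp
    then have "S * (\<alpha>2 + 1 - \<alpha>1) = 0" using f'[of "\<alpha>2 + 1"] by simp
    then show False using assms(3,4) by simp
  qed
  then show ?thesis unfolding f sign Pt using t0 by auto
qed

text \<open>Multiplied by \<open>E\<close> and \<open>E\<^sup>2\<close>, the trace and the
  discriminant become a positive power of \<open>\<beta>\<^sup>2\<close> times a function of the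
  ratio \<open>t\<close> alone. Their signs therefore depend only on \<open>t\<close>.\<close>

lemma M1_stability_larger_root:
  fixes l :: "real ^ 4"
  assumes ord: "l$1 > l$2" "l$2 > l$3" "l$3 > l$4"
    and pos: "\<And>i j. i \<noteq> j \<Longrightarrow> l$i + l$j > 0"
    and roots: "\<alpha>1 < \<alpha>2" "{t. f_tilde l t = 0} = {\<alpha>1, \<alpha>2}"
    and "\<beta> \<noteq> 0" "\<alpha>\<^sup>2 \<noteq> \<beta>\<^sup>2"
  shows "\<alpha>\<^sup>2 / \<beta>\<^sup>2 < \<alpha>2 \<Longrightarrow> spectrally_unstable (rigid_body l) (M1 \<alpha> \<beta>)"
    and "\<alpha>\<^sup>2 / \<beta>\<^sup>2 \<ge> \<alpha>2 \<Longrightarrow> spectrally_stable (rigid_body l) (M1 \<alpha> \<beta>)"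
proof -
  define T where "T = trace (lin_A l \<alpha> \<beta> ** lin_B l \<alpha> \<beta>)"
  define D where "D = det (lin_A l \<alpha> \<beta> ** lin_B l \<alpha> \<beta>)"
  define E where "E = (l$1 + l$2) * (l$1 + l$3) * (l$2 + l$4) * (l$3 + l$4)"
  define p where "p = (l$1 - l$3) * (l$3 - l$4) * (l$1 + l$2) * (l$2 + l$4) +
       (l$2 - l$4) * (l$1 - l$2) * (l$1 + l$3) * (l$3 + l$4)"
  define q where "q = (l$1 - l$3) * (l$1 - l$2) * (l$3 + l$4) * (l$2 + l$4) +
       (l$2 - l$4) * (l$3 - l$4) * (l$1 + l$2) * (l$1 + l$3)"
  define r where "r = ((l$1)\<^sup>2 - (l$2)\<^sup>2) * ((l$3)\<^sup>2 - (l$4)\<^sup>2) * ((l$1)\<^sup>2 - (l$3)\<^sup>2) * ((l$2)\<^sup>2 - (l$4)\<^sup>2)"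
  define g where "g = 1 / (l$1 + l$4)\<^sup>2"
  define h where "h = 1 / (l$2 + l$3)\<^sup>2"
  define t where "t = \<alpha>\<^sup>2 / \<beta>\<^sup>2"
  note sums = pos[of 1 2] pos[of 1 3] pos[of 1 4] pos[of 2 3] pos[of 2 4] pos[of 3 4]
  have E: "E > 0" unfolding E_def using sums by simp
  have \<beta>: "\<beta>\<^sup>2 > 0" using assms(7) by simp
  have sq: "(l$i)\<^sup>2 - (l$j)\<^sup>2 > 0" if "l$j < l$i" "i \<noteq> j" for i j
    using that pos[OF that(2)] by (simp add: square_diff_square_factored power2_eq_square)
  have r: "r \<ge> 0" unfolding r_def using ord by (intro mult_nonneg_nonneg less_imp_le[OF sq]) auto
  have h: "h > 0" "h \<noteq> 0" "g > 0" unfolding h_def g_def using sums by simp_all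
  have "q > 0" unfolding q_def
    by (rule add_pos_pos; intro mult_pos_pos; use ord sums in simp)
  then have q: "q * h > 0" using h by simp
  have ET: "E * T = \<beta>\<^sup>2 * (p * g - (q * h) * t)"
    using trace_lin[OF pos, of \<alpha> \<beta>] \<beta> unfolding T_def E_def p_def[symmetric] q_def[symmetric]
    by (simp add: g_def h_def t_def algebra_simps)
  \<comment> \<open>The second factor \<open>E\<close> turns the product of differences into the
    product \<open>r\<close> of differences of squares.\<close>
  have "E * (E * D) = E * ((l$1 - l$2) * (l$3 - l$4) * (l$1 - l$3) * (l$2 - l$4) *
      (\<beta>\<^sup>2 / (l$1 + l$4)\<^sup>2 - \<alpha>\<^sup>2 / (l$2 + l$3)\<^sup>2)\<^sup>2)"
    using det_lin[OF pos, of \<alpha> \<beta>] unfolding D_def E_def by simp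
  also have "\<dots> = r * (\<beta>\<^sup>2 / (l$1 + l$4)\<^sup>2 - \<alpha>\<^sup>2 / (l$2 + l$3)\<^sup>2)\<^sup>2"
    unfolding E_def r_def power2_eq_square[of "l$_"] square_diff_square_factored by (simp only: mult_ac)
  also have "\<beta>\<^sup>2 / (l$1 + l$4)\<^sup>2 - \<alpha>\<^sup>2 / (l$2 + l$3)\<^sup>2 = \<beta>\<^sup>2 * (g - h * t)"
    using \<beta> by (simp add: g_def h_def t_def algebra_simps)
  finally have ED: "E\<^sup>2 * D = r * (\<beta>\<^sup>2 * (g - h * t))\<^sup>2" by (simp add: power2_eq_square mult_ac)
  have "E\<^sup>2 * D \<ge> 0" unfolding ED using r by simp
  then have D: "D \<ge> 0" using E by (simp add: zero_le_mult_iff)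
  have T: "T \<le> 0 \<longleftrightarrow> p * g - (q * h) * t \<le> 0"
  proof -
    have "T \<le> 0 \<longleftrightarrow> E * T \<le> 0" using E by (simp add: mult_le_0_iff)
    then show ?thesis unfolding ET using \<beta> by (simp add: mult_le_0_iff)
  qed
  have "E\<^sup>2 * (T\<^sup>2 - 4 * D) = (E * T)\<^sup>2 - 4 * (E\<^sup>2 * D)"
    by (simp add: power2_eq_square algebra_simps)
  also have "\<dots> = (\<beta>\<^sup>2)\<^sup>2 * ((p * g - (q * h) * t)\<^sup>2 - 4 * r * (g - h * t)\<^sup>2)"
  proof -
    have "(x * W)\<^sup>2 - 4 * (r * (x * V)\<^sup>2) = x\<^sup>2 * (W\<^sup>2 - 4 * r * V\<^sup>2)" for x V W
      by (simp add: power2_eq_square algebra_simps)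
    then show ?thesis unfolding ET ED .
  qed
  finally have "E\<^sup>2 * (T\<^sup>2 - 4 * D) = (\<beta>\<^sup>2)\<^sup>2 * ((p * g - (q * h) * t)\<^sup>2 - 4 * r * (g - h * t)\<^sup>2)" .
  then have disc: "T\<^sup>2 - 4 * D \<ge> 0 \<longleftrightarrow> (p * g - (q * h) * t)\<^sup>2 - 4 * r * (g - h * t)\<^sup>2 \<ge> 0"
    using E \<beta> by (smt (verit) zero_le_mult_iff zero_less_power)
  define k where "k = (2 * (l$2 * l$3 - l$1 * l$4) / ((l$1 + l$4) * (l$2 + l$3)))\<^sup>2"
  have f: "(p * g - (q * h) * s)\<^sup>2 - 4 * r * (g - h * s)\<^sup>2 = k * f_tilde l s" for s
    using discriminant_eq_f_tilde[OF pos, of s] unfolding p_def q_def r_def g_def h_def k_def by simp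
  have iff: "T\<^sup>2 - 4 * D \<ge> 0 \<and> T \<le> 0 \<longleftrightarrow> \<alpha>2 \<le> t"
  proof (cases "l$2 * l$3 = l$1 * l$4")
    case True
    then have "k = 0" by (simp add: k_def)
    \<comment> \<open>At \<open>s = g / h\<close> the determinant term vanishes, so the identically
      zero discriminant yields \<open>p = q\<close>. The trace then changes sign exactly at
      \<open>g / h\<close>, which is the larger root.\<close>
    have "(p * g - (q * h) * (g / h))\<^sup>2 = 0" using f[of "g / h"] h \<open>k = 0\<close> by simp
    then have "p = q" using h by simp
    have "\<alpha>2 = g / h"
      using f_tilde_larger_root_degenerate[OF ord pos roots True] by (simp add: g_def h_def)
    moreover have "p * g - (q * h) * t \<le> 0 \<longleftrightarrow> g / h \<le> t"
      using \<open>q > 0\<close> h unfolding \<open>p = q\<close> by (simp add: mult.assoc pos_divide_le_eq mult.commute)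
    ultimately show ?thesis unfolding disc T f \<open>k = 0\<close> by simp
  next
    case False
    then have "k > 0" using sums by (simp add: k_def)
    then have "k * ((l$1)\<^sup>2 - (l$4)\<^sup>2)\<^sup>2 > 0" using sq[of 4 1] ord by simp
    moreover have "(p * g - (q * h) * s)\<^sup>2 - 4 * r * (g - h * s)\<^sup>2 =
        k * ((l$1)\<^sup>2 - (l$4)\<^sup>2)\<^sup>2 * (s - \<alpha>1) * (s - \<alpha>2)" for s
      unfolding f f_tilde_factorization[OF roots] by (simp only: mult.assoc)
    ultimately show ?thesis
      unfolding disc T by (intro above_larger_root_iff[OF q r _ roots(1)])
  qed
  show "spectrally_unstable (rigid_body l) (M1 \<alpha> \<beta>)" if "\<alpha>\<^sup>2 / \<beta>\<^sup>2 < \<alpha>2"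
    using M1_stability_trace_det(1)[OF assms(8), of l] iff that unfolding T_def D_def t_def by linarith
  show "spectrally_stable (rigid_body l) (M1 \<alpha> \<beta>)" if "\<alpha>\<^sup>2 / \<beta>\<^sup>2 \<ge> \<alpha>2"
    using M1_stability_trace_det(2)[OF assms(8), of l] iff D that unfolding T_def D_def t_def by blast
qed

section \<open>The two equilibria on the regular orbit\<close>

theorem theorem4p1:
  fixes l :: "real ^ 4" and c1 c2 a b \<alpha>1 \<alpha>2 :: real
  assumes "l$1 > l$2" and "l$2 > l$3" and "l$3 > l$4"
    and "\<forall>i j. i \<noteq> j \<longrightarrow> l$i + l$j > 0"
    and "c1 > 0" and "c1 > \<bar>c2\<bar>"
    and "a = 1 / sqrt 2 * (sqrt (c1 + c2) + sqrt (c1 - c2))"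
    and "b = 1 / sqrt 2 * (sqrt (c1 + c2) - sqrt (c1 - c2))"
    and "\<alpha>1 < \<alpha>2" and "{t. f_tilde l t = 0} = {\<alpha>1, \<alpha>2}"
  shows "0 \<le> b\<^sup>2 / a\<^sup>2 \<and> b\<^sup>2 / a\<^sup>2 < 1 \<and>
    (\<forall>z \<in> {M1 b a, M1 (-b) (-a)}.
       z \<in> orbit c1 c2 \<and> equilibrium (rigid_body l) z \<and>
       ((l$1)\<^sup>2 + (l$4)\<^sup>2 = (l$2)\<^sup>2 + (l$3)\<^sup>2 \<longrightarrow>
          spectrally_unstable (rigid_body l) z) \<and>
       ((l$1)\<^sup>2 + (l$4)\<^sup>2 \<noteq> (l$2)\<^sup>2 + (l$3)\<^sup>2 \<longrightarrow>
          (b\<^sup>2 / a\<^sup>2 \<in> {0..<\<alpha>2} \<longrightarrow> spectrally_unstable (rigid_body l) z) \<and>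
          (b\<^sup>2 / a\<^sup>2 \<in> {\<alpha>2..<1} \<longrightarrow> spectrally_stable (rigid_body l) z)))"
proof -
  define u where "u = sqrt (c1 + c2)"
  define v where "v = sqrt (c1 - c2)"
  have uv: "u > 0" "v > 0" "u\<^sup>2 = c1 + c2" "v\<^sup>2 = c1 - c2"
    using assms(6) by (auto simp: u_def v_def)
  have a: "a = (u + v) / sqrt 2" and b: "b = (u - v) / sqrt 2"
    using assms(7,8) by (simp_all add: u_def v_def)
  \<comment> \<open>The first two identities place the points on the orbit; the third makes the
    ratio less than 1 and the Casimir differentials independent.\<close>
  have "a\<^sup>2 + b\<^sup>2 = u\<^sup>2 + v\<^sup>2" "2 * (a * b) = u\<^sup>2 - v\<^sup>2" "a\<^sup>2 - b\<^sup>2 = 2 * u * v"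
    unfolding a b by (simp_all add: power_divide) (simp_all add: power2_eq_square field_simps)
  then have ab: "a\<^sup>2 + b\<^sup>2 = 2 * c1" "a * b = c2" "b\<^sup>2 < a\<^sup>2"
    using uv mult_pos_pos[of u v] by linarith+
  have a0: "a \<noteq> 0" unfolding a using uv by simp
  have lt1: "b\<^sup>2 / a\<^sup>2 < 1" using ab(3) a0 by (simp add: divide_simps)
  have orbit: "M1 b a \<in> orbit c1 c2" "M1 (-b) (-a) \<in> orbit c1 c2"
    using ab by (simp_all add: orbit_def casimir1_def casimir2_def M1_def sum_3 axis_def algebra_simps)
  have eq: "equilibrium (rigid_body l) (M1 \<alpha> \<beta>)" for \<alpha> \<beta>
    by (simp add: equilibrium_def rigid_body_def M1_def Let_def axis_def prod_eq_iff vec_eq_iff forall_3)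
  \<comment> \<open>In \<open>M1 b a\<close> the roles are \<open>\<alpha> = b\<close> and
    \<open>\<beta> = a\<close>; negating both leaves the squares, and so the ratio,
    unchanged.\<close>
  have unstable: "spectrally_unstable (rigid_body l) z"
    if "b\<^sup>2 / a\<^sup>2 < \<alpha>2" "z \<in> {M1 b a, M1 (-b) (-a)}" for z
    using that M1_stability_larger_root(1)[OF assms(1-3) _ assms(9,10), of a b]
      M1_stability_larger_root(1)[OF assms(1-3) _ assms(9,10), of "- a" "- b"] assms(4) a0 ab(3) by auto
  have stable: "spectrally_stable (rigid_body l) z"
    if "b\<^sup>2 / a\<^sup>2 \<ge> \<alpha>2" "z \<in> {M1 b a, M1 (-b) (-a)}" for z
    using that M1_stability_larger_root(2)[OF assms(1-3) _ assms(9,10), of a b]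
      M1_stability_larger_root(2)[OF assms(1-3) _ assms(9,10), of "- a" "- b"] assms(4) a0 ab(3) by auto
  \<comment> \<open>Under the equality of sums of squares, 1 is a root of \<open>f_tilde\<close>, so
    every ratio below 1 lies below \<alpha>2 and falls under the unstable case.\<close>
  have "1 \<le> \<alpha>2" if "(l$1)\<^sup>2 + (l$4)\<^sup>2 = (l$2)\<^sup>2 + (l$3)\<^sup>2"
  proof -
    have "f_tilde l 1 = (((l$1)\<^sup>2 + (l$4)\<^sup>2) - ((l$2)\<^sup>2 + (l$3)\<^sup>2))\<^sup>2"
      unfolding f_tilde_def Let_def power2_eq_square[of "l$_"]
      by (simp add: power2_eq_square algebra_simps)
    then have "f_tilde l 1 = 0" using that by simp
    then have "1 \<in> {\<alpha>1, \<alpha>2}" using assms(10) by blast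
    then show ?thesis using assms(9) by auto
  qed
  then show ?thesis using lt1 orbit eq unstable stable by fastforce
qed

end
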